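(* Let $a>0$ and let $\phi(z)=cz+d$ where $c\in\mathbb{R}$ with $0<|c|\leq 1$ and $d\in\mathbb{C}$. Then the composition operator $C_\phi f=f\circ\phi$ is positively expansive on $B^2_a$ if and only if $0<|c|<1$.
   Context: For $a>0$, the Paley-Wiener space $B^2_a$ is the Hilbert space of all entire functions of exponential type less than or equal to $a$ whose restriction to $\mathbb{R}$ belongs to $L^2(\mathbb{R})$, with inner product $\langle f,g\rangle=\int_{-\infty}^{\infty}f(t)\overline{g(t)}\,dt$ and norm $\|\cdot\|_a$. For symbols $\phi(z)=cz+d$ ($z\in\mathbb{C}$) with $c\in\mathbb{R}$, $0<|c|\leq1$, $d\in\mathbb{C}$, the operator $C_\phi$ is a bounded linear operator on $B^2_a$. A continuous linear operator $T$ on a complex Banach space $E$ is positively expansive if for each $x\in E$ with $\|x\|=1$ there exists a positive integer $n$ such that $\|T^nx\|\geq 2$. *)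

theory Defs
  imports "HOL-Complex_Analysis.Complex_Analysis"
begin

definition exp_type_le :: "real \<Rightarrow> (complex \<Rightarrow> complex) \<Rightarrow> bool" where
  "exp_type_le a f \<longleftrightarrow>
     (\<forall>\<epsilon>>0. \<exists>C. \<forall>z. norm (f z) \<le> C * exp ((a + \<epsilon>) * norm z))"

text \<open>The restriction of an entire function to the real line is continuous, hence measurable,
  so membership in $L^2$ is integrability of the square of the modulus. Distinct entire functions
  differ on a set of positive measure of the real line, so no quotient is needed.\<close>

definition paley_wiener :: "real \<Rightarrow> (complex \<Rightarrow> complex) set" where
  "paley_wiener a = {f. f holomorphic_on UNIV \<and> exp_type_le a f \<and>
     integrable lborel (\<lambda>t::real. (norm (f (of_real t)))\<^sup>2)}"

definition pw_inner :: "(complex \<Rightarrow> complex) \<Rightarrow> (complex \<Rightarrow> complex) \<Rightarrow> complex" where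
  "pw_inner f g = (LINT t|lborel. f (of_real (t::real)) * cnj (g (of_real t)))"

definition pw_norm :: "(complex \<Rightarrow> complex) \<Rightarrow> real" where
  "pw_norm f = sqrt (Re (pw_inner f f))"

definition comp_op :: "('a \<Rightarrow> 'a) \<Rightarrow> ('a \<Rightarrow> complex) \<Rightarrow> ('a \<Rightarrow> complex)" where
  "comp_op \<phi> f = f \<circ> \<phi>"

text \<open>The library has no class of complex Banach spaces, and the space above depends on a real
  parameter. A space is therefore given as a set \<open>E\<close> of complex-valued functions with the pointwise
  vector space operations, together with a norm \<open>N\<close>. The values of an operator outside \<open>E\<close>
  are irrelevant.\<close>

definition bounded_linear_operator_on ::
    "('a \<Rightarrow> complex) set \<Rightarrow> (('a \<Rightarrow> complex) \<Rightarrow> real) \<Rightarrow>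
     (('a \<Rightarrow> complex) \<Rightarrow> ('a \<Rightarrow> complex)) \<Rightarrow> bool" where
  "bounded_linear_operator_on E N T \<longleftrightarrow>
     (\<forall>f\<in>E. T f \<in> E) \<and>
     (\<forall>f\<in>E. \<forall>g\<in>E. T (\<lambda>z. f z + g z) = (\<lambda>z. T f z + T g z)) \<and>
     (\<forall>\<alpha>. \<forall>f\<in>E. T (\<lambda>z. \<alpha> * f z) = (\<lambda>z. \<alpha> * T f z)) \<and>
     (\<exists>K. \<forall>f\<in>E. N (T f) \<le> K * N f)"

definition positively_expansive ::
    "('a \<Rightarrow> complex) set \<Rightarrow> (('a \<Rightarrow> complex) \<Rightarrow> real) \<Rightarrow>
     (('a \<Rightarrow> complex) \<Rightarrow> ('a \<Rightarrow> complex)) \<Rightarrow> bool" where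
  "positively_expansive E N T \<longleftrightarrow>
     bounded_linear_operator_on E N T \<and>
     (\<forall>f\<in>E. N f = 1 \<longrightarrow> (\<exists>n>0. N ((T ^^ n) f) \<ge> 2))"

end

theory Submission
  imports Defs "HOL-Probability.Sinc_Integral"
begin

text \<open>
  The iterates are \<open>C\<^sup>n f(z) = f(c\<^sup>n z + s\<^sub>n d)\<close> with \<open>s\<^sub>n = 1 + c + \<dots> + c\<^bsup>n-1\<^esup>\<close>. By the Plancherel-Polya
  inequality a translation by \<open>w\<close> changes the norm by a factor between \<open>exp (- a \<bar>Im w\<bar>)\<close> and
  \<open>exp (a \<bar>Im w\<bar>)\<close>. If \<open>\<bar>c\<bar> < 1\<close>, the \<open>s\<^sub>n\<close> are bounded while the dilation contributes the factor
  \<open>\<bar>c\<bar>\<^bsup>-n/2\<^esup>\<close>, so the orbit of every nonzero vector tends to infinity in norm. If \<open>\<bar>c\<bar> = 1\<close>, then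
  \<open>s\<^sub>n \<ge> 0\<close>, and a nonzero \<open>f\<close> whose spectrum lies on the appropriate side of \<open>0\<close> satisfies
  \<open>\<parallel>C\<^sup>n f\<parallel> \<le> \<parallel>f\<parallel>\<close> for all \<open>n\<close>.

  The Plancherel-Polya inequality itself follows from the Phragmen-Lindelof principle, applied to the
  convolutions of \<open>f\<close> with compactly supported square integrable functions.
\<close>

section \<open>Phragmen-Lindelof principle\<close>

text \<open>The maximum modulus principle on \<open>S\<close> cut off by a large ball: a frontier
  point of the intersection lies either on the frontier of \<open>S\<close> or in \<open>S\<close>
  with modulus at least \<open>R\<close>.\<close>

lemma maximum_modulus_eventually_bounded:
  assumes "open S" "f holomorphic_on closure S"
    and frontier: "\<And>z. z \<in> frontier S \<Longrightarrow> norm (f z) \<le> B"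
    and large: "\<And>z. z \<in> S \<Longrightarrow> R \<le> norm z \<Longrightarrow> norm (f z) \<le> B"
    and "w \<in> S"
  shows "norm (f w) \<le> B"
proof -
  define r where "r = max R (norm w + 1)"
  have r: "R \<le> r" "norm w < r" "0 < r"
    using norm_ge_zero[of w] unfolding r_def by linarith+
  show ?thesis
  proof (rule maximum_modulus_frontier[of f "S \<inter> ball 0 r" B w])
    show "f holomorphic_on interior (S \<inter> ball 0 r)"
      using assms(2) by (rule holomorphic_on_subset) (use closure_subset interior_subset in blast)
    show "continuous_on (closure (S \<inter> ball 0 r)) f"
      using holomorphic_on_imp_continuous_on[OF assms(2)]
      by (rule continuous_on_subset) (simp add: closure_mono)
    show "bounded (S \<inter> ball 0 r)" by (simp add: bounded_Int)
    show "w \<in> S \<inter> ball 0 r" using assms r by auto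
    fix z assume "z \<in> frontier (S \<inter> ball 0 r)"
    then have "z \<in> closure S" "z \<in> cball 0 r" "z \<notin> S \<inter> ball 0 r"
      using closure_mono[of "S \<inter> ball 0 r" S] closure_mono[of "S \<inter> ball 0 r" "ball 0 r"] r assms(1)
      by (auto simp: frontier_def interior_open open_Int)
    then consider "z \<in> frontier S" | "z \<in> S" "norm z = r"
      using assms(1) by (force simp: frontier_def interior_open)
    then show "norm (f z) \<le> B"
      using frontier large r by cases auto
  qed
qed

text \<open>A point with argument in [0, pi/4] has its cube in the sector [0, 3 pi/4], which leaves
  the right half plane. The factor \<open>1 - 2 * \<i>\<close> turns this sector clockwise by arctan
  2, back strictly inside the right half plane.\<close>

lemma Re_cube_first_octant:
  fixes p q :: real
  assumes "0 \<le> q" "q \<le> p"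
  shows "p ^ 3 \<le> Re ((1 - 2 * \<i>) * Complex p q ^ 3)"
proof -
  have "Re ((1 - 2 * \<i>) * Complex p q ^ 3) = p ^ 3 - 3 * p * q\<^sup>2 + 2 * (3 * p\<^sup>2 * q - q ^ 3)"
    by (simp add: power3_eq_cube power2_eq_square algebra_simps)
  moreover have "q * (3 * p * q) \<le> q * (3 * p\<^sup>2)" "q ^ 3 \<le> p\<^sup>2 * q"
    using assms by (auto simp: power2_eq_square power3_eq_cube intro!: mult_mono mult_left_mono)
  moreover have "0 \<le> p\<^sup>2 * q" using assms by simp
  ultimately show ?thesis by (simp add: power2_eq_square algebra_simps)
qed

text \<open>Halving the argument sends the quadrant into the octant where
  \<open>Re_cube_first_octant\<close> applies. There \<open>p\<close> alone controls the modulus of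
  \<open>z\<close>, because \<open>q\<close> contributes at most as much as
  \<open>p\<close>.\<close>

lemma csqrt_first_quadrant:
  assumes "0 < Re z" "0 \<le> Im z"
  obtains p q where "csqrt z = Complex p q" "0 \<le> q" "q \<le> p" "norm z \<le> 2 * p\<^sup>2"
proof -
  define p q where "p = Re (csqrt z)" and "q = Im (csqrt z)"
  have z: "Complex p q ^ 2 = z" unfolding p_def q_def complex_surj by simp
  have eq: "Re z = p\<^sup>2 - q\<^sup>2" "Im z = 2 * p * q"
    using z by (auto simp: power2_eq_square)
  have "0 \<le> p" unfolding p_def by (rule Re_csqrt)
  moreover have "p \<noteq> 0" using eq(1) assms by (auto simp: not_less)
  ultimately have p: "0 < p" by simp
  then have q: "0 \<le> q" using eq(2) assms by (simp add: zero_le_mult_iff)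
  have qp: "q\<^sup>2 \<le> p\<^sup>2" using eq(1) assms by linarith
  have "q \<le> p" using qp p by (simp add: power2_le_iff_abs_le)
  moreover have "norm z \<le> 2 * p\<^sup>2"
    using qp norm_power[of "Complex p q" 2] unfolding z cmod_power2 by simp
  moreover have "csqrt z = Complex p q" unfolding p_def q_def by (rule complex_surj[symmetric])
  ultimately show ?thesis using q that by blast
qed

lemma frontier_quadrant:
  assumes "z \<in> frontier {z. 0 < Re z \<and> 0 < Im z}"
  shows "0 \<le> Re z" "0 \<le> Im z" "Re z = 0 \<or> Im z = 0"
proof -
  have o: "open {z. 0 < Re z \<and> 0 < Im z}"
    by (intro open_Collect_conj open_Collect_less continuous_intros)
  have "closed {z. 0 \<le> Re z \<and> 0 \<le> Im z}"
    by (intro closed_Collect_conj closed_Collect_le continuous_intros)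
  then have "closure {z. 0 < Re z \<and> 0 < Im z} \<subseteq> {z. 0 \<le> Re z \<and> 0 \<le> Im z}"
    by (intro closure_minimal) auto
  then show "0 \<le> Re z" "0 \<le> Im z" "Re z = 0 \<or> Im z = 0"
    using assms o by (auto simp: frontier_def interior_open)
qed

text \<open>The damping factor \<open>exp (- \<delta> (1 - 2\<i>) (z + 1)\<^bsup>3/2\<^esup>)\<close> is bounded by \<open>1\<close> on the quadrant and beats every
  growth of order \<open>1\<close>. The shift by \<open>1\<close> keeps the branch point of the square root off the closed
  quadrant.\<close>

lemma phragmen_lindelof_quadrant:
  assumes holf: "f holomorphic_on UNIV"
    and growth: "\<And>z. norm (f z) \<le> C * exp (K * norm z)"
    and pos: "0 < B"
    and bnd: "\<And>z. 0 \<le> Re z \<Longrightarrow> 0 \<le> Im z \<Longrightarrow> Re z = 0 \<or> Im z = 0 \<Longrightarrow> norm (f z) \<le> B"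
    and w: "0 < Re w" "0 < Im w"
  shows "norm (f w) \<le> B"
proof -
  define S where "S = {z. 0 < Re z \<and> 0 < Im z}"
  define E where "E = (\<lambda>z. (1 - 2 * \<i>) * csqrt (z + 1) ^ 3)"
  have oS: "open S" unfolding S_def
    by (intro open_Collect_conj open_Collect_less continuous_intros)
  have clS: "closure S \<subseteq> {z. 0 \<le> Re z \<and> 0 \<le> Im z}" unfolding S_def
    by (intro closure_minimal) (auto intro!: closed_Collect_conj closed_Collect_le continuous_intros)
  have hE: "E holomorphic_on closure S"
    using clS unfolding E_def
    by (intro holomorphic_intros) (auto simp: complex_nonpos_Reals_iff)
  \<comment> \<open>In effect \<open>Re (E z)\<close> is at least \<open>norm z / 2\<close> to the
    power 3/2; the parameter \<open>p\<close> avoids fractional powers.\<close>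
  have E: "\<exists>p\<ge>0. p ^ 3 \<le> Re (E z) \<and> norm z \<le> 2 * p\<^sup>2" if "0 \<le> Re z" "0 \<le> Im z" for z
  proof -
    have "0 < Re (z + 1)" "0 \<le> Im (z + 1)" using that by auto
    then obtain p q where pq: "csqrt (z + 1) = Complex p q" "0 \<le> q" "q \<le> p" "norm (z + 1) \<le> 2 * p\<^sup>2"
      by (rule csqrt_first_quadrant)
    have "norm z \<le> norm (z + 1)"
      using that by (auto simp: cmod_def intro!: power_mono)
    then show ?thesis
      using pq Re_cube_first_octant[of q p] by (auto simp: E_def intro!: exI[of _ p])
  qed
  have C0: "0 \<le> C" using growth[of 0] norm_ge_zero[of "f 0"] by (simp del: norm_ge_zero)
  have key: "norm (f w) * exp (- \<delta> * Re (E w)) \<le> B" if \<delta>: "0 < \<delta>" for \<delta>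
  proof -
    have nrm: "norm (f z * exp (- (of_real \<delta> * E z))) = norm (f z) * exp (- \<delta> * Re (E z))" for z
      by (simp add: norm_mult)
    \<comment> \<open>This makes \<open>\<delta> * P\<close> at least
      \<open>2 * \<bar>K\<bar> + C / B\<close>, so that for \<open>p \<ge> P\<close> the damping
      \<open>\<delta> * p ^ 3\<close> absorbs \<open>K * norm z\<close> and still leaves a factor
      \<open>exp (- (C / B))\<close>. The summand 1 ensures
      \<open>1 \<le> p\<^sup>2\<close>.\<close>
    define P where "P = 1 + (2 * \<bar>K\<bar> + C / B) / \<delta>"
    have "norm (f w * exp (- (of_real \<delta> * E w))) \<le> B"
    proof (rule maximum_modulus_eventually_bounded[where S = S and R = "2 * P\<^sup>2"
          and f = "\<lambda>z. f z * exp (- (of_real \<delta> * E z))"])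
      show "(\<lambda>z. f z * exp (- (of_real \<delta> * E z))) holomorphic_on closure S"
        by (intro holomorphic_intros hE holomorphic_on_subset[OF holf]) auto
    next
      fix z assume "z \<in> frontier S"
      then have z: "0 \<le> Re z" "0 \<le> Im z" "Re z = 0 \<or> Im z = 0"
        unfolding S_def by (rule frontier_quadrant)+
      then obtain p where "0 \<le> p" "p ^ 3 \<le> Re (E z)" using E by blast
      then have "0 \<le> Re (E z)" by (meson order_trans zero_le_power)
      then have "exp (- \<delta> * Re (E z)) \<le> 1" using \<delta> by simp
      then have "norm (f z) * exp (- \<delta> * Re (E z)) \<le> B * 1"
        using bnd[OF z] pos by (intro mult_mono) auto
      then show "norm (f z * exp (- (of_real \<delta> * E z))) \<le> B" unfolding nrm by simp
    next
      fix z assume "z \<in> S" and R: "2 * P\<^sup>2 \<le> norm z"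
      then have z: "0 \<le> Re z" "0 \<le> Im z" unfolding S_def by auto
      then obtain p where p: "0 \<le> p" "p ^ 3 \<le> Re (E z)" "norm z \<le> 2 * p\<^sup>2" using E by blast
      have "P\<^sup>2 \<le> p\<^sup>2" using p R by linarith
      then have Pp: "P \<le> p" using p by (simp add: power2_le_iff_abs_le)
      have P1: "1 \<le> P" using \<delta> pos C0 by (simp add: P_def)
      have "2 * \<bar>K\<bar> + C / B \<le> \<delta> * P"
        using \<delta> by (simp add: P_def field_simps)
      also have "\<dots> \<le> \<delta> * p" using Pp \<delta> by simp
      finally have "p\<^sup>2 * (2 * \<bar>K\<bar> + C / B) \<le> p\<^sup>2 * (\<delta> * p)" by (rule mult_left_mono) simp
      then have 1: "\<bar>K\<bar> * (2 * p\<^sup>2) + p\<^sup>2 * (C / B) \<le> \<delta> * p ^ 3"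
        by (simp add: power2_eq_square power3_eq_cube algebra_simps)
      have 2: "\<delta> * p ^ 3 \<le> \<delta> * Re (E z)" using p \<delta> by simp
      have 3: "K * norm z \<le> \<bar>K\<bar> * (2 * p\<^sup>2)"
        using p by (meson abs_ge_self abs_ge_zero mult_mono norm_ge_zero)
      have "1 \<le> p\<^sup>2" using P1 Pp by (simp add: one_le_power)
      then have 4: "C / B \<le> p\<^sup>2 * (C / B)"
        using C0 pos mult_right_mono[of 1 "p\<^sup>2" "C / B"] by simp
      have "norm (f z) * exp (- \<delta> * Re (E z)) \<le> C * exp (K * norm z) * exp (- \<delta> * Re (E z))"
        by (intro mult_right_mono growth) simp
      also have "\<dots> = C * exp (K * norm z - \<delta> * Re (E z))" by (simp add: exp_diff exp_minus field_simps)
      also have "\<dots> \<le> C * exp (- (C / B))"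
        using 1 2 3 4 C0 by (intro mult_left_mono) auto
      also have "\<dots> \<le> B"
      proof -
        have "C / B \<le> exp (C / B)" using exp_ge_add_one_self[of "C / B"] by linarith
        then have "C \<le> B * exp (C / B)" using pos by (simp add: field_simps)
        then show ?thesis by (simp add: exp_minus field_simps)
      qed
      finally show "norm (f z * exp (- (of_real \<delta> * E z))) \<le> B" unfolding nrm .
    qed (use oS w in \<open>auto simp: S_def\<close>)
    then show ?thesis unfolding nrm .
  qed
  have "((\<lambda>\<delta>. norm (f w) * exp (- \<delta> * Re (E w))) \<longlongrightarrow> norm (f w) * exp (- 0 * Re (E w))) (at_right 0)"
    by (intro tendsto_intros)
  moreover have "eventually (\<lambda>\<delta>. norm (f w) * exp (- \<delta> * Re (E w)) \<le> B) (at_right (0::real))"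
    using key by (auto simp: eventually_at_right_field intro!: exI[of _ 1])
  ultimately show ?thesis
    using tendsto_upperbound[of _ _ "at_right 0" B] by fastforce
qed

text \<open>The quadrant result on both halves of the upper half plane gives some bound
  \<open>D\<close>; a second maximum modulus argument lowers \<open>D\<close> to \<open>B\<close>.
  The constant \<open>A\<close> serves only to obtain boundedness.\<close>

lemma phragmen_lindelof_half_plane:
  assumes holf: "f holomorphic_on UNIV"
    and growth: "\<And>z. norm (f z) \<le> C * exp (K * norm z)"
    and imag: "\<And>z. Re z = 0 \<Longrightarrow> 0 \<le> Im z \<Longrightarrow> norm (f z) \<le> A"
    and real: "\<And>z. Im z = 0 \<Longrightarrow> norm (f z) \<le> B"
    and w: "0 < Im w"
  shows "norm (f w) \<le> B"
proof -
  \<comment> \<open>The 1 keeps \<open>D\<close> positive, as the quadrant lemma and the quotient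
    \<open>D / (D / \<delta>) = \<delta>\<close> require.\<close>
  define D where "D = max 1 (max A B)"
  have bounded: "norm (f z) \<le> D" if "0 \<le> Im z" for z
  proof -
    consider "Im z = 0 \<or> Re z = 0" | "0 < Re z" "0 < Im z" | "Re z < 0" "0 < Im z"
      using \<open>0 \<le> Im z\<close> by fastforce
    then show ?thesis
    proof cases
      case 1
      then show ?thesis using imag[of z] real[of z] that by (auto simp: D_def)
    next
      case 2
      show ?thesis
        by (rule phragmen_lindelof_quadrant[OF holf growth _ _ 2])
           (use imag real in \<open>fastforce simp: D_def\<close>)+
    next
      case 3
      \<comment> \<open>The rotation by \<open>\<i>\<close> carries the first quadrant to the
        second.\<close>
      have "norm (f (\<i> * (- \<i> * z))) \<le> D"
      proof (rule phragmen_lindelof_quadrant[of "\<lambda>z. f (\<i> * z)" C K])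
        show "(\<lambda>z. f (\<i> * z)) holomorphic_on UNIV"
          using holomorphic_on_compose_gen[of "\<lambda>z. \<i> * z" UNIV f UNIV] holf
          by (auto simp: o_def intro!: holomorphic_intros)
        show "norm (f (\<i> * z)) \<le> C * exp (K * norm z)" for z
          using growth[of "\<i> * z"] by (simp add: norm_mult)
        show "norm (f (\<i> * z)) \<le> D" if "0 \<le> Re z" "0 \<le> Im z" "Re z = 0 \<or> Im z = 0" for z
          using imag[of "\<i> * z"] real[of "\<i> * z"] that by (auto simp: D_def)
      qed (use 3 in \<open>auto simp: D_def\<close>)
      then show ?thesis by (simp add: mult.assoc[symmetric])
    qed
  qed
  text \<open>Dividing by \<open>1 - \<i>\<delta>z\<close>, whose modulus is at least \<open>1\<close> on the half plane, makes the bounded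
    function vanish at infinity, so that only the bound on the real axis survives.\<close>
  define S where "S = {z. 0 < Im z}"
  have oS: "open S" unfolding S_def by (simp add: open_halfspace_Im_gt)
  have clS: "closure S \<subseteq> {z. 0 \<le> Im z}" unfolding S_def
    by (intro closure_minimal) (auto simp: closed_halfspace_Im_ge)
  have B0: "0 \<le> B" using real[of 0] norm_ge_zero order_trans by (metis zero_complex.sel(2))
  have key: "norm (f w) / norm (1 - of_real \<delta> * \<i> * w) \<le> B + \<delta>" if \<delta>: "0 < \<delta>" for \<delta>
  proof -
    have Re: "Re (1 - of_real \<delta> * \<i> * z) = 1 + \<delta> * Im z" for z by simp
    have ge1: "1 \<le> norm (1 - of_real \<delta> * \<i> * z)" if "0 \<le> Im z" for z
      using complex_Re_le_cmod[of "1 - of_real \<delta> * \<i> * z"] \<delta> that unfolding Re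
      by (smt (verit) mult_nonneg_nonneg)
    have "norm (f w / (1 - of_real \<delta> * \<i> * w)) \<le> B + \<delta>"
    \<comment> \<open>Beyond this radius the denominator has modulus at least
      \<open>\<delta> * norm z - 1 \<ge> D / \<delta>\<close>, so the quotient is at most
      \<open>\<delta>\<close>.\<close>
    proof (rule maximum_modulus_eventually_bounded[where S = S and R = "(D / \<delta> + 1) / \<delta>"
          and f = "\<lambda>z. f z / (1 - of_real \<delta> * \<i> * z)"])
      show "(\<lambda>z. f z / (1 - of_real \<delta> * \<i> * z)) holomorphic_on closure S"
        using clS ge1 by (intro holomorphic_intros holomorphic_on_subset[OF holf]) fastforce+
    next
      fix z assume "z \<in> frontier S"
      then have z: "Im z = 0" using clS oS unfolding frontier_def S_def by (auto simp: interior_open)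
      have "norm (f z) / norm (1 - of_real \<delta> * \<i> * z) \<le> B / 1"
        using real[OF z] ge1[of z] z B0 by (intro frac_le) auto
      then show "norm (f z / (1 - of_real \<delta> * \<i> * z)) \<le> B + \<delta>"
        using \<delta> by (simp add: norm_divide)
    next
      fix z assume z: "z \<in> S" "(D / \<delta> + 1) / \<delta> \<le> norm z"
      have "norm (of_real \<delta> * \<i> * z) \<le> norm (1 - of_real \<delta> * \<i> * z) + 1"
        using norm_triangle_ineq4[of 1 "1 - of_real \<delta> * \<i> * z"] by simp
      then have "\<delta> * norm z \<le> norm (1 - of_real \<delta> * \<i> * z) + 1" using \<delta> by (simp add: norm_mult)
      moreover have "D / \<delta> + 1 \<le> \<delta> * norm z" using z \<delta> by (simp add: field_simps)
      ultimately have "D / \<delta> \<le> norm (1 - of_real \<delta> * \<i> * z)" by linarith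
      then have "norm (f z) / norm (1 - of_real \<delta> * \<i> * z) \<le> D / (D / \<delta>)"
        using bounded[of z] z \<delta> by (intro frac_le) (auto simp: S_def D_def)
      then show "norm (f z / (1 - of_real \<delta> * \<i> * z)) \<le> B + \<delta>"
        using \<delta> B0 by (simp add: norm_divide D_def split: if_splits)
    qed (use oS w in \<open>auto simp: S_def\<close>)
    then show ?thesis by (simp add: norm_divide)
  qed
  have "((\<lambda>\<delta>. norm (f w) / norm (1 - of_real \<delta> * \<i> * w)) \<longlongrightarrow> norm (f w) / norm (1 - of_real 0 * \<i> * w)) (at_right 0)"
    by (intro tendsto_intros) auto
  moreover have "((\<lambda>\<delta>. B + \<delta>) \<longlongrightarrow> B + 0) (at_right 0)" by (intro tendsto_intros)
  moreover have "eventually (\<lambda>\<delta>. norm (f w) / norm (1 - of_real \<delta> * \<i> * w) \<le> B + \<delta>) (at_right (0::real))"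
    using key by (auto simp: eventually_at_right_field intro!: exI[of _ 1])
  ultimately have "norm (f w) / norm (1 - of_real 0 * \<i> * w) \<le> B + 0"
    by (intro tendsto_le[of "at_right 0"]) auto
  then show ?thesis by simp
qed

text \<open>The factor \<open>exp (\<i> * (a + \<epsilon>) * z)\<close> has modulus 1 on the real
  axis and compensates the growth along the positive imaginary axis, so the half-plane principle
  applies; then \<open>\<epsilon>\<close> tends to 0. The reflection \<open>z\<close> to
  \<open>- z\<close> settles the lower half plane.\<close>

lemma exp_type_bounded_on_reals:
  assumes holf: "f holomorphic_on UNIV" and "exp_type_le a f" "0 \<le> a"
    and real: "\<And>x::real. norm (f (of_real x)) \<le> B"
  shows "norm (f z) \<le> B * exp (a * \<bar>Im z\<bar>)"
proof -
  have upper: "norm (g w) \<le> B * exp (a * Im w)"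
    if holg: "g holomorphic_on UNIV" and gtype: "exp_type_le a g"
      and real: "\<And>x::real. norm (g (of_real x)) \<le> B" and w: "0 < Im w" for g w
  proof -
    have key: "norm (g w) * exp (- (a + \<epsilon>) * Im w) \<le> B" if \<epsilon>: "0 < \<epsilon>" for \<epsilon>
    proof -
      obtain C where C: "\<And>z. norm (g z) \<le> C * exp ((a + \<epsilon>) * norm z)"
        using gtype \<epsilon> unfolding exp_type_le_def by blast
      have C0: "0 \<le> C" using C[of 0] norm_ge_zero[of "g 0"] by (simp del: norm_ge_zero)
      have nrm: "norm (g z * exp (\<i> * of_real (a + \<epsilon>) * z)) = norm (g z) * exp (- (a + \<epsilon>) * Im z)" for z
        by (simp add: norm_mult algebra_simps)
      have "norm (g w * exp (\<i> * of_real (a + \<epsilon>) * w)) \<le> B"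
      \<comment> \<open>Each factor contributes \<open>(a + \<epsilon>) * norm z\<close> to the
        exponent, hence \<open>K\<close>; on the positive imaginary axis the two cancel exactly,
        hence \<open>A = C\<close>.\<close>
      proof (rule phragmen_lindelof_half_plane[where C = C and K = "2 * (a + \<epsilon>)" and A = C
          and f = "\<lambda>z. g z * exp (\<i> * of_real (a + \<epsilon>) * z)"])
        show "(\<lambda>z. g z * exp (\<i> * of_real (a + \<epsilon>) * z)) holomorphic_on UNIV"
          by (intro holomorphic_intros holg)
      next
        fix z
        have "- (a + \<epsilon>) * Im z \<le> (a + \<epsilon>) * norm z"
          using abs_Im_le_cmod[of z] assms(3) \<epsilon>
          by (metis abs_le_D2 add_nonneg_pos less_eq_real_def minus_mult_commute mult_left_mono)
        then have "norm (g z) * exp (- (a + \<epsilon>) * Im z) \<le> C * exp ((a + \<epsilon>) * norm z) * exp ((a + \<epsilon>) * norm z)"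
          using C[of z] C0 by (intro mult_mono) auto
        also have "\<dots> = C * exp (2 * (a + \<epsilon>) * norm z)"
          by (simp add: exp_add[symmetric] algebra_simps)
        finally show "norm (g z * exp (\<i> * of_real (a + \<epsilon>) * z)) \<le> C * exp (2 * (a + \<epsilon>) * norm z)"
          unfolding nrm .
      next
        fix z :: complex assume z: "Re z = 0" "0 \<le> Im z"
        then have "norm z = Im z" by (simp add: cmod_def)
        then show "norm (g z * exp (\<i> * of_real (a + \<epsilon>) * z)) \<le> C"
          using C[of z] unfolding nrm
          by (simp add: exp_minus field_simps del: minus_add_distrib)
      next
        fix z :: complex assume z: "Im z = 0"
        then have "z = of_real (Re z)" by (simp add: complex_eq_iff)
        then show "norm (g z * exp (\<i> * of_real (a + \<epsilon>) * z)) \<le> B"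
          unfolding nrm using real[of "Re z"] z by simp
      qed (fact w)
      then show ?thesis unfolding nrm .
    qed
    have "((\<lambda>\<epsilon>. norm (g w) * exp (- (a + \<epsilon>) * Im w)) \<longlongrightarrow> norm (g w) * exp (- (a + 0) * Im w)) (at_right 0)"
      by (intro tendsto_intros)
    moreover have "eventually (\<lambda>\<epsilon>. norm (g w) * exp (- (a + \<epsilon>) * Im w) \<le> B) (at_right (0::real))"
      using key by (auto simp: eventually_at_right_field intro!: exI[of _ 1])
    ultimately have "norm (g w) * exp (- (a + 0) * Im w) \<le> B"
      by (intro tendsto_upperbound[of _ _ "at_right 0"]) auto
    then show ?thesis by (simp add: exp_minus field_simps)
  qed
  consider "Im z = 0" | "0 < Im z" | "Im z < 0" by linarith
  then show ?thesis
  proof cases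
    case 1
    then have "z = of_real (Re z)" by (simp add: complex_eq_iff)
    then show ?thesis using real[of "Re z"] 1 by simp
  next
    case 2
    then show ?thesis using upper[OF holf assms(2) real 2] by simp
  next
    case 3
    have "norm (f (- (- z))) \<le> B * exp (a * Im (- z))"
    proof (rule upper[of "\<lambda>z. f (- z)"])
      show "(\<lambda>z. f (- z)) holomorphic_on UNIV"
        using holomorphic_on_compose_gen[OF holomorphic_on_minus[OF holomorphic_on_ident] holf]
        by (simp add: o_def)
      show "exp_type_le a (\<lambda>z. f (- z))"
        using assms(2) unfolding exp_type_le_def by (metis norm_minus_cancel)
      show "norm (f (- of_real x)) \<le> B" for x using real[of "- x"] by simp
    qed (use 3 in simp)
    then show ?thesis using 3 by simp
  qed
qed

section \<open>Plancherel-Polya inequality\<close>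

text \<open>Monotone convergence along the intervals \<open>{- real n..real n}\<close>.\<close>

lemma integrable_lborel_if_interval_bounded:
  fixes u :: "real \<Rightarrow> real"
  assumes cont: "continuous_on UNIV u" and nonneg: "\<And>t. 0 \<le> u t"
    and bnd: "\<And>N. integral {- N..N} u \<le> K"
  shows "integrable lborel u" "(LINT t|lborel. u t) \<le> K"
proof -
  \<comment> \<open>For \<open>N = -1\<close> the interval is empty and the integral is 0.\<close>
  have K: "0 \<le> K" using bnd[of "-1"] by simp
  have [measurable]: "u \<in> borel_measurable lborel"
    using borel_measurable_continuous_onI[OF cont] by simp
  have segment: "(\<integral>\<^sup>+t. ennreal (indicator {- real n..real n} t * u t) \<partial>lborel) \<le> ennreal K" for n
  proof -
    have "set_integrable lborel {- real n..real n} u"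
      by (intro borel_integrable_atLeastAtMost' continuous_on_subset[OF cont]) auto
    then show ?thesis
      using set_borel_integral_eq_integral(2)[of "{- real n..real n}" u] bnd[of "real n"] nonneg
      by (subst nn_integral_eq_integral)
         (auto simp: set_integrable_def set_lebesgue_integral_def intro!: ennreal_leI)
  qed
  have sup: "(SUP n. ennreal (indicator {- real n..real n} t * u t)) = ennreal (u t)" for t
  proof (rule antisym)
    obtain n where "\<bar>t\<bar> \<le> real n" using real_arch_simple by blast
    then show "ennreal (u t) \<le> (SUP n. ennreal (indicator {- real n..real n} t * u t))"
      by (intro SUP_upper2[of n]) (auto simp: indicator_def abs_le_iff)
  qed (auto intro!: SUP_least ennreal_leI simp: nonneg indicator_def)
  have "(\<integral>\<^sup>+t. ennreal (u t) \<partial>lborel) = (SUP n. \<integral>\<^sup>+t. ennreal (indicator {- real n..real n} t * u t) \<partial>lborel)"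
    unfolding sup[symmetric]
    by (rule nn_integral_monotone_convergence_SUP)
       (auto simp: incseq_def le_fun_def indicator_def nonneg intro!: ennreal_leI)
  also have "\<dots> \<le> ennreal K" by (intro SUP_least segment)
  finally have le: "(\<integral>\<^sup>+t. ennreal (u t) \<partial>lborel) \<le> ennreal K" .
  then show "integrable lborel u"
    using nonneg by (intro integrableI_bounded) (auto intro: le_less_trans)
  show "(LINT t|lborel. u t) \<le> K" using integral_real_bounded[OF K le] .
qed

lemma integral_interval_le_lborel:
  fixes u :: "real \<Rightarrow> real"
  assumes "continuous_on UNIV u" "integrable lborel u" "\<And>t. 0 \<le> u t"
  shows "integral {a..b} u \<le> (LINT t|lborel. u t)"
  unfolding integral_lborel[OF assms(2), symmetric]
  using assms by (intro integral_subset_le integrable_on_lborel integrable_continuous_real)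
    (auto intro: continuous_on_subset)

text \<open>Differentiation under the integral sign; over a compact interval continuity of the
  integrand and of its derivative suffices.\<close>

lemma holomorphic_translate_compact_convolution:
  fixes f :: "complex \<Rightarrow> complex" and h :: "real \<Rightarrow> complex"
  assumes holf: "f holomorphic_on UNIV" and conth: "continuous_on UNIV h"
  shows "(\<lambda>z. integral {- N..N} (\<lambda>t. f (z + of_real t) * h t)) holomorphic_on UNIV"
proof -
  have cf: "continuous_on UNIV f" using holf by (rule holomorphic_on_imp_continuous_on)
  have cdf: "continuous_on UNIV (deriv f)"
    using holomorphic_deriv[OF holf] by (intro holomorphic_on_imp_continuous_on) auto
  have "(\<lambda>z. integral (cbox (- N) N) (\<lambda>t. f (z + of_real t) * h t)) holomorphic_on UNIV"
  proof (rule leibniz_rule_holomorphic[where fx = "\<lambda>z t. deriv f (z + of_real t) * h t"])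
    fix z :: complex and t :: real
    have "(f has_field_derivative deriv f (z + of_real t)) (at (z + of_real t))"
      using holf by (simp add: holomorphic_derivI)
    then show "((\<lambda>z. f (z + of_real t) * h t) has_field_derivative deriv f (z + of_real t) * h t)
        (at z within UNIV)"
      by (auto intro!: DERIV_cmult_right simp: DERIV_shift)
  next
    fix z
    show "(\<lambda>t. f (z + of_real t) * h t) integrable_on cbox (- N) N"
      by (intro integrable_continuous continuous_intros continuous_on_compose2[OF cf]
          continuous_on_compose2[OF conth]) auto
  next
    show "continuous_on (UNIV \<times> cbox (- N) N) (\<lambda>(z, t). deriv f (z + of_real t) * h t)"
      unfolding case_prod_beta
      by (intro continuous_intros continuous_on_compose2[OF cdf] continuous_on_compose2[OF conth]) auto
  qed auto
  then show ?thesis by simp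
qed

text \<open>A shift by \<open>t\<close> in \<open>{- N..N}\<close> costs at most the factor
  \<open>exp ((a + \<epsilon>) * \<bar>N\<bar>)\<close>, which goes into the constant.\<close>

lemma exp_type_compact_convolution:
  fixes f :: "complex \<Rightarrow> complex" and h :: "real \<Rightarrow> complex"
  assumes contf: "continuous_on UNIV f" and conth: "continuous_on UNIV h"
    and ftype: "exp_type_le a f" and "0 \<le> a"
  shows "exp_type_le a (\<lambda>z. integral {- N..N} (\<lambda>t. f (z + of_real t) * h t))"
  unfolding exp_type_le_def
proof (intro allI impI)
  fix \<epsilon> :: real assume \<epsilon>: "0 < \<epsilon>"
  obtain C where C: "\<And>z. norm (f z) \<le> C * exp ((a + \<epsilon>) * norm z)"
    using ftype \<epsilon> unfolding exp_type_le_def by blast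
  have C0: "0 \<le> C" using C[of 0] norm_ge_zero[of "f 0"] by (simp del: norm_ge_zero)
  have "compact (h ` {- N..N})"
    by (intro compact_continuous_image continuous_on_subset[OF conth]) auto
  then obtain H where H: "0 < H" "\<And>t. t \<in> {- N..N} \<Longrightarrow> norm (h t) \<le> H"
    using compact_imp_bounded bounded_pos by (metis image_eqI)
  \<comment> \<open>The absolute values cover negative \<open>N\<close>, where the interval is
    empty.\<close>
  have "norm (integral {- N..N} (\<lambda>t. f (z + of_real t) * h t))
      \<le> (\<bar>2 * N\<bar> * (C * exp ((a + \<epsilon>) * \<bar>N\<bar>) * H)) * exp ((a + \<epsilon>) * norm z)" for z
  proof -
    define D where "D = C * exp ((a + \<epsilon>) * (norm z + \<bar>N\<bar>)) * H"
    have D0: "0 \<le> D" using C0 H by (simp add: D_def)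
    have "norm (integral {- N..N} (\<lambda>t. f (z + of_real t) * h t)) \<le> integral {- N..N} (\<lambda>t. D)"
    proof (rule integral_norm_bound_integral)
      show "(\<lambda>t. f (z + of_real t) * h t) integrable_on {- N..N}"
        by (intro integrable_continuous_real continuous_intros continuous_on_compose2[OF contf]
            continuous_on_compose2[OF conth]) auto
      fix t assume t: "t \<in> {- N..N}"
      have "norm (z + of_real t) \<le> norm z + \<bar>N\<bar>"
        using norm_triangle_ineq[of z "of_real t"] t by auto
      then have "C * exp ((a + \<epsilon>) * norm (z + of_real t)) \<le> C * exp ((a + \<epsilon>) * (norm z + \<bar>N\<bar>))"
        using C0 \<epsilon> \<open>0 \<le> a\<close> by (intro mult_left_mono) auto
      then have "norm (f (z + of_real t)) \<le> C * exp ((a + \<epsilon>) * (norm z + \<bar>N\<bar>))"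
        using C[of "z + of_real t"] by linarith
      then show "norm (f (z + of_real t) * h t) \<le> D"
        unfolding norm_mult D_def using H t C0 by (intro mult_mono) auto
    qed auto
    also have "\<dots> \<le> \<bar>2 * N\<bar> * D"
      using D0 by (cases "0 \<le> N") (auto simp: mult_nonneg_nonpos)
    also have "\<dots> = (\<bar>2 * N\<bar> * (C * exp ((a + \<epsilon>) * \<bar>N\<bar>) * H)) * exp ((a + \<epsilon>) * norm z)"
      by (simp add: D_def distrib_left exp_add)
    finally show ?thesis .
  qed
  then show "\<exists>C. \<forall>z. norm (integral {- N..N} (\<lambda>t. f (z + of_real t) * h t)) \<le> C * exp ((a + \<epsilon>) * norm z)"
    by blast
qed

lemma AM_GM_product:
  fixes x y l :: real
  assumes "0 < l"
  shows "x * y \<le> (l * x\<^sup>2 + y\<^sup>2 / l) / 2"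
proof -
  have "0 \<le> (l * x - y)\<^sup>2 / l" using assms by simp
  also have "\<dots> = l * x\<^sup>2 + y\<^sup>2 / l - 2 * (x * y)"
    using assms by (simp add: field_simps power2_eq_square)
  finally show ?thesis by simp
qed

text \<open>Take \<open>G(z) = \<integral>\<^bsub>[-N,N]\<^esub> f(z + t) h(t) dt\<close> with \<open>h(t)\<close> the conjugate of \<open>f(w + t)\<close>. Then
  \<open>I = G(w)\<close> is the quantity to bound, and \<open>G\<close> is of exponential type \<open>a\<close>. The weight \<open>l\<close> in the
  AM-GM bound of \<open>G\<close> on the real axis is chosen such that \<open>I\<close> reappears with coefficient \<open>1/2\<close>
  and can be absorbed.\<close>

lemma plancherel_polya:
  assumes f: "f \<in> paley_wiener a" and a: "0 \<le> a"
  shows "integrable lborel (\<lambda>t::real. (norm (f (of_real t + w)))\<^sup>2)" (is ?int)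
    and "(LINT t|lborel. (norm (f (of_real t + w)))\<^sup>2)
           \<le> exp (2 * a * \<bar>Im w\<bar>) * (LINT t|lborel. (norm (f (of_real t)))\<^sup>2)" (is ?le)
proof -
  have holf: "f holomorphic_on UNIV" and ftype: "exp_type_le a f"
    and L2: "integrable lborel (\<lambda>t::real. (norm (f (of_real t)))\<^sup>2)"
    using f by (auto simp: paley_wiener_def)
  define L where "L = (LINT t|lborel. (norm (f (of_real t)))\<^sup>2)"
  have cf: "continuous_on UNIV f" using holf by (rule holomorphic_on_imp_continuous_on)
  have cshift: "continuous_on A (\<lambda>t::real. f (of_real t + z))" for z A
    by (intro continuous_intros continuous_on_compose2[OF cf]) auto
  have cu: "continuous_on A (\<lambda>t::real. (norm (f (of_real t + z)))\<^sup>2)" for z A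
    by (intro continuous_intros cshift)
  \<comment> \<open>Integrability of the translate is itself part of the claim, so the estimate is
    made on compact intervals, uniformly in \<open>N\<close>.\<close>
  have "integral {- N..N} (\<lambda>t. (norm (f (of_real t + w)))\<^sup>2) \<le> exp (2 * a * \<bar>Im w\<bar>) * L" for N
  proof -
    define h where "h = (\<lambda>t::real. cnj (f (of_real t + w)))"
    define G where "G = (\<lambda>z. integral {- N..N} (\<lambda>t. f (z + of_real t) * h t))"
    define I where "I = integral {- N..N} (\<lambda>t. (norm (f (of_real t + w)))\<^sup>2)"
    define l where "l = exp (a * \<bar>Im w\<bar>)"
    have l: "0 < l" by (simp add: l_def)
    have conth: "continuous_on A h" for A
      unfolding h_def by (intro continuous_intros cshift)
    have "norm (G w) \<le> ((l * L + I / l) / 2) * exp (a * \<bar>Im w\<bar>)"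
    proof (rule exp_type_bounded_on_reals[OF _ _ a])
      show "G holomorphic_on UNIV"
        unfolding G_def by (rule holomorphic_translate_compact_convolution[OF holf conth])
      show "exp_type_le a G"
        unfolding G_def by (rule exp_type_compact_convolution[OF cf conth ftype a])
      fix x :: real
      \<comment> \<open>Lebesgue measure is invariant under real shifts, so one bound serves all
        points \<open>x\<close> of the real axis.\<close>
      have int_shift: "integrable lborel (\<lambda>t. (norm (f (of_real t + of_real x)))\<^sup>2)"
        and eq_shift: "L = (LINT t|lborel. (norm (f (of_real t + of_real x)))\<^sup>2)"
        using lborel_integrable_real_affine[OF L2, of 1 x]
          lborel_integral_real_affine[of 1 "\<lambda>t. (norm (f (of_real t)))\<^sup>2" x]
        by (simp_all add: L_def add.commute)
      have "norm (G (of_real x)) \<le> integral {- N..N}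
          (\<lambda>t. (l * (norm (f (of_real t + of_real x)))\<^sup>2 + (norm (f (of_real t + w)))\<^sup>2 / l) / 2)"
        unfolding G_def
      proof (rule integral_norm_bound_integral)
        show "(\<lambda>t. f (of_real x + of_real t) * h t) integrable_on {- N..N}"
          using cshift[of _ "of_real x"] conth
          by (intro integrable_continuous_real continuous_intros) (auto simp: add.commute)
        show "(\<lambda>t. (l * (norm (f (of_real t + of_real x)))\<^sup>2 + (norm (f (of_real t + w)))\<^sup>2 / l) / 2)
            integrable_on {- N..N}"
          using l by (intro integrable_continuous_real continuous_intros cshift) auto
        fix t
        show "norm (f (of_real x + of_real t) * h t)
            \<le> (l * (norm (f (of_real t + of_real x)))\<^sup>2 + (norm (f (of_real t + w)))\<^sup>2 / l) / 2"
          using AM_GM_product[OF l, of "norm (f (of_real t + of_real x))" "norm (f (of_real t + w))"]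
          by (simp add: norm_mult h_def add.commute)
      qed
      also have "\<dots> = (l * integral {- N..N} (\<lambda>t. (norm (f (of_real t + of_real x)))\<^sup>2) + I / l) / 2"
        unfolding I_def
        by (intro integral_unique has_integral_divide has_integral_add has_integral_mult_right
            integrable_integral integrable_continuous_real cu)
      also have "\<dots> \<le> (l * L + I / l) / 2"
        using integral_interval_le_lborel[OF cu int_shift, of "- N" N] l
        unfolding eq_shift by (simp add: add_right_mono divide_right_mono mult_left_mono)
      finally show "norm (G (of_real x)) \<le> (l * L + I / l) / 2" .
    qed
    moreover have "G w = of_real I"
    proof -
      have "G w = integral {- N..N} (\<lambda>t. of_real ((norm (f (of_real t + w)))\<^sup>2))"
        unfolding G_def h_def complex_norm_square by (simp add: add.commute)
      also have "\<dots> = of_real I"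
        unfolding I_def by (intro integral_unique has_integral_of_real integrable_integral
            integrable_continuous_real cu)
      finally show ?thesis .
    qed
    ultimately have "I \<le> (l * L + I / l) / 2 * l" by (simp add: l_def)
    also have "\<dots> = (l\<^sup>2 * L + I) / 2" using l by (simp add: field_simps power2_eq_square)
    finally have "I \<le> l\<^sup>2 * L" by simp
    also have "l\<^sup>2 = exp (2 * a * \<bar>Im w\<bar>)"
      unfolding l_def by (simp add: power2_eq_square exp_add[symmetric])
    finally show ?thesis unfolding I_def .
  qed
  from integrable_lborel_if_interval_bounded[OF cu _ this]
  show ?int ?le unfolding L_def by simp_all
qed

section \<open>Composition operators\<close>

lemma pw_norm_eq: "pw_norm f = sqrt (LINT t|lborel. (norm (f (of_real t)))\<^sup>2)"
  unfolding pw_norm_def pw_inner_def complex_norm_square[symmetric] integral_complex_of_real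
  by simp

lemma pw_norm_scale: "pw_norm (\<lambda>z. \<alpha> * f z) = norm \<alpha> * pw_norm f"
  by (simp add: pw_norm_eq norm_mult power_mult_distrib real_sqrt_mult)

lemma paley_wiener_scale:
  assumes "f \<in> paley_wiener a"
  shows "(\<lambda>z. \<alpha> * f z) \<in> paley_wiener a"
proof -
  have "exp_type_le a (\<lambda>z. \<alpha> * f z)"
    unfolding exp_type_le_def
  proof (intro allI impI)
    fix \<epsilon> :: real assume "0 < \<epsilon>"
    then obtain C where "\<And>z. norm (f z) \<le> C * exp ((a + \<epsilon>) * norm z)"
      using assms unfolding paley_wiener_def exp_type_le_def by blast
    then have "norm (\<alpha> * f z) \<le> (norm \<alpha> * C) * exp ((a + \<epsilon>) * norm z)" for z
      by (simp add: norm_mult mult_left_mono mult.assoc)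
    then show "\<exists>C. \<forall>z. norm (\<alpha> * f z) \<le> C * exp ((a + \<epsilon>) * norm z)" by blast
  qed
  then show ?thesis
    using assms by (auto simp: paley_wiener_def norm_mult power_mult_distrib intro!: holomorphic_intros)
qed

lemma exp_type_affine:
  assumes ftype: "exp_type_le a f" and "0 \<le> a" "\<bar>c\<bar> \<le> 1"
  shows "exp_type_le a (\<lambda>z. f (of_real c * z + w))"
  unfolding exp_type_le_def
proof (intro allI impI)
  fix \<epsilon> :: real assume \<epsilon>: "0 < \<epsilon>"
  obtain C where C: "\<And>z. norm (f z) \<le> C * exp ((a + \<epsilon>) * norm z)"
    using ftype \<epsilon> unfolding exp_type_le_def by blast
  have C0: "0 \<le> C" using C[of 0] norm_ge_zero[of "f 0"] by (simp del: norm_ge_zero)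
  have "norm (f (of_real c * z + w)) \<le> (C * exp ((a + \<epsilon>) * norm w)) * exp ((a + \<epsilon>) * norm z)" for z
  proof -
    have "\<bar>c\<bar> * norm z \<le> norm z" using assms(3) by (simp add: mult_left_le_one_le)
    then have "norm (of_real c * z + w) \<le> norm z + norm w"
      using norm_triangle_ineq[of "of_real c * z" w] by (simp add: norm_mult)
    then have "C * exp ((a + \<epsilon>) * norm (of_real c * z + w)) \<le> C * exp ((a + \<epsilon>) * (norm z + norm w))"
      using C0 \<epsilon> \<open>0 \<le> a\<close> by (intro mult_left_mono) auto
    also have "\<dots> = (C * exp ((a + \<epsilon>) * norm w)) * exp ((a + \<epsilon>) * norm z)"
      by (simp add: distrib_left exp_add)
    finally show ?thesis using C order_trans by blast
  qed
  then show "\<exists>C. \<forall>z. norm (f (of_real c * z + w)) \<le> C * exp ((a + \<epsilon>) * norm z)" by blast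
qed

text \<open>The substitution \<open>t\<close> to \<open>c * t\<close> isolates the dilation as an
  exact factor. The translation is left inside the integral, where Plancherel-Polya estimates it
  from either side.\<close>

lemma paley_wiener_affine:
  assumes f: "f \<in> paley_wiener a" and a: "0 \<le> a" and c: "c \<noteq> 0" "\<bar>c\<bar> \<le> 1"
  shows "(\<lambda>z. f (of_real c * z + w)) \<in> paley_wiener a"
    and "(pw_norm (\<lambda>z. f (of_real c * z + w)))\<^sup>2
           = (LINT t|lborel. (norm (f (of_real t + w)))\<^sup>2) / \<bar>c\<bar>"
proof -
  have holf: "f holomorphic_on UNIV" using f by (simp add: paley_wiener_def)
  have "(\<lambda>z. f (of_real c * z + w)) holomorphic_on UNIV"
    using holomorphic_on_compose_gen[of "\<lambda>z. of_real c * z + w" UNIV f UNIV] holf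
    by (simp add: o_def holomorphic_intros)
  moreover have "integrable lborel (\<lambda>t::real. (norm (f (of_real c * of_real t + w)))\<^sup>2)"
    using lborel_integrable_real_affine[OF plancherel_polya(1)[OF f a, of w] c(1), of 0] by simp
  ultimately show "(\<lambda>z. f (of_real c * z + w)) \<in> paley_wiener a"
    using f a c exp_type_affine by (simp add: paley_wiener_def)
  show "(pw_norm (\<lambda>z. f (of_real c * z + w)))\<^sup>2
      = (LINT t|lborel. (norm (f (of_real t + w)))\<^sup>2) / \<bar>c\<bar>"
    using lborel_integral_real_affine[OF c(1), of "\<lambda>t. (norm (f (of_real t + w)))\<^sup>2" 0] c
    by (simp add: pw_norm_eq)
qed

text \<open>The upper estimate applied to the translate by \<open>w\<close>, shifted back by
  \<open>- w\<close>.\<close>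

lemma plancherel_polya_lower:
  assumes f: "f \<in> paley_wiener a" and a: "0 \<le> a"
  shows "(LINT t|lborel. (norm (f (of_real t)))\<^sup>2)
           \<le> exp (2 * a * \<bar>Im w\<bar>) * (LINT t|lborel. (norm (f (of_real t + w)))\<^sup>2)"
proof -
  have "(\<lambda>z. f (z + w)) \<in> paley_wiener a"
    using paley_wiener_affine(1)[OF f a, of 1 w] by simp
  from plancherel_polya(2)[OF this a, of "- w"] show ?thesis by simp
qed

lemma comp_op_bounded:
  assumes a: "0 \<le> a" and c: "c \<noteq> 0" "\<bar>c\<bar> \<le> 1"
  shows "bounded_linear_operator_on (paley_wiener a) pw_norm (comp_op (\<lambda>z. of_real c * z + d))"
proof -
  define K where "K = sqrt (exp (2 * a * \<bar>Im d\<bar>) / \<bar>c\<bar>)"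
  have "pw_norm (\<lambda>z. f (of_real c * z + d)) \<le> K * pw_norm f" if f: "f \<in> paley_wiener a" for f
  proof (rule power2_le_imp_le)
    have "(pw_norm (\<lambda>z. f (of_real c * z + d)))\<^sup>2
        \<le> exp (2 * a * \<bar>Im d\<bar>) * (LINT t|lborel. (norm (f (of_real t)))\<^sup>2) / \<bar>c\<bar>"
      unfolding paley_wiener_affine(2)[OF f a c]
      by (intro divide_right_mono plancherel_polya[OF f a]) simp
    then show "(pw_norm (\<lambda>z. f (of_real c * z + d)))\<^sup>2 \<le> (K * pw_norm f)\<^sup>2"
      by (simp add: pw_norm_eq[of f] K_def power_mult_distrib)
  qed (simp add: K_def pw_norm_eq)
  then have "\<exists>K. \<forall>f\<in>paley_wiener a. pw_norm (\<lambda>z. f (of_real c * z + d)) \<le> K * pw_norm f"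
    by blast
  then show ?thesis
    using paley_wiener_affine(1)[OF _ a c]
    by (simp add: bounded_linear_operator_on_def comp_op_def o_def)
qed

lemma comp_op_funpow: "(comp_op \<phi> ^^ n) f = f \<circ> (\<phi> ^^ n)"
proof (induction n)
  case (Suc n)
  have "(comp_op \<phi> ^^ Suc n) f = f \<circ> (\<phi> ^^ n) \<circ> \<phi>" 
    by (simp add: Suc) (simp add: comp_op_def fun_eq_iff)
  then show ?case by (simp only: funpow_Suc_right o_assoc)
qed simp

lemma affine_funpow:
  fixes c :: real and d :: complex
  shows "((\<lambda>z. of_real c * z + d) ^^ n) z = of_real (c ^ n) * z + of_real (\<Sum>k<n. c ^ k) * d"
proof (induction n)
  case (Suc n)
  \<comment> \<open>The outermost application of the map sends the shift \<open>s\<close> to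
    \<open>c * s + d\<close>, so the term \<open>k = 0\<close> is split off rather than the last
    one.\<close>
  have "(\<Sum>k<Suc n. c ^ k) = 1 + c * (\<Sum>k<n. c ^ k)"
    by (simp add: sum.lessThan_Suc_shift sum_distrib_left del: sum.lessThan_Suc)
  then show ?case using Suc by (simp add: algebra_simps)
qed simp

lemma pw_norm_comp_op_funpow:
  assumes f: "f \<in> paley_wiener a" and a: "0 \<le> a" and c: "c \<noteq> 0" "\<bar>c\<bar> \<le> 1"
  shows "(pw_norm ((comp_op (\<lambda>z. of_real c * z + d) ^^ n) f))\<^sup>2
    = (LINT t|lborel. (norm (f (of_real t + of_real (\<Sum>k<n. c ^ k) * d)))\<^sup>2) / \<bar>c\<bar> ^ n"
proof -
  have "(comp_op (\<lambda>z. of_real c * z + d) ^^ n) f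
      = (\<lambda>z. f (of_real (c ^ n) * z + of_real (\<Sum>k<n. c ^ k) * d))"
    by (simp add: comp_op_funpow o_def affine_funpow)
  moreover have "c ^ n \<noteq> 0" "\<bar>c ^ n\<bar> \<le> 1"
    using c by (simp_all add: power_abs power_le_one)
  ultimately show ?thesis
    using paley_wiener_affine(2)[OF f a, of "c ^ n"] by (simp add: power_abs)
qed

section \<open>Nonzero vectors whose translates do not grow\<close>

lemma norm_sin_le_exp: "norm (sin z) \<le> exp (norm (z::complex))"
proof -
  have "norm (exp (\<i> * z) - exp (- (\<i> * z))) \<le> norm (exp (\<i> * z)) + norm (exp (- (\<i> * z)))"
    by (rule norm_triangle_ineq4)
  also have "\<dots> \<le> exp (norm z) + exp (norm z)"
    using norm_exp[of "\<i> * z"] norm_exp[of "- (\<i> * z)"] by (intro add_mono) (simp_all add: norm_mult)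
  finally show ?thesis by (simp add: sin_exp_eq norm_divide norm_mult)
qed

text \<open>The witness \<open>sin (b * z) / z\<close> is, up to a constant, the Fourier transform
  of the indicator function of \<open>[-b, b]\<close>.\<close>

lemma paley_wiener_nontrivial:
  assumes b: "0 < b"
  obtains g where "g \<in> paley_wiener b" "0 < (LINT t|lborel. (norm (g (of_real t)))\<^sup>2)"
proof -
  \<comment> \<open>The value at 0 is the derivative of \<open>sin (b * z)\<close> there, which
    removes the singularity.\<close>
  define g where "g = (\<lambda>z::complex. if z = 0 then of_real b else sin (of_real b * z) / z)"
  have "((\<lambda>z. sin (of_real b * z)) has_field_derivative of_real b) (at (0::complex))"
    by (auto intro!: derivative_eq_intros)
  then have d: "deriv (\<lambda>z::complex. sin (of_real b * z)) 0 = of_real b"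
    by (rule DERIV_imp_deriv)
  have holg: "g holomorphic_on UNIV"
  proof -
    have "(\<lambda>z::complex. sin (of_real b * z)) holomorphic_on UNIV" by (intro holomorphic_intros)
    from pole_lemma[OF this, of 0] show ?thesis by (simp add: d g_def cong: if_cong)
  qed
  then have contg: "continuous_on UNIV g" by (rule holomorphic_on_imp_continuous_on)
  have cu: "continuous_on A (\<lambda>t::real. (norm (g (of_real t)))\<^sup>2)" for A
    by (intro continuous_intros continuous_on_compose2[OF contg]) auto
  have "compact (g ` cball 0 1)"
    by (intro compact_continuous_image continuous_on_subset[OF contg]) auto
  then obtain M where M: "0 < M" "\<And>z. z \<in> cball 0 1 \<Longrightarrow> norm (g z) \<le> M"
    using compact_imp_bounded bounded_pos by (metis image_eqI)
  have gtype: "exp_type_le b g"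
    unfolding exp_type_le_def
  proof (intro allI impI exI)
    fix \<epsilon> :: real and z :: complex assume \<epsilon>: "0 < \<epsilon>"
    have le: "exp (b * norm z) \<le> exp ((b + \<epsilon>) * norm z)" "1 \<le> exp ((b + \<epsilon>) * norm z)"
      using \<epsilon> b by (simp_all add: mult_right_mono)
    show "norm (g z) \<le> max M 1 * exp ((b + \<epsilon>) * norm z)"
    proof (cases "norm z \<le> 1")
      case True
      then have "norm (g z) \<le> max M 1 * 1" using M(2)[of z] by simp
      also have "\<dots> \<le> max M 1 * exp ((b + \<epsilon>) * norm z)"
        using le by (intro mult_left_mono) auto
      finally show ?thesis .
    next
      case False
      then have "norm (g z) = norm (sin (of_real b * z)) / norm z" by (auto simp: g_def norm_divide)
      also have "\<dots> \<le> norm (sin (of_real b * z)) / 1"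
        using False by (intro divide_left_mono) auto
      also have "\<dots> \<le> 1 * exp ((b + \<epsilon>) * norm z)"
        using order_trans[OF norm_sin_le_exp[of "of_real b * z"], of "exp ((b + \<epsilon>) * norm z)"] le b
        by (simp add: norm_mult)
      also have "\<dots> \<le> max M 1 * exp ((b + \<epsilon>) * norm z)" by (intro mult_right_mono) auto
      finally show ?thesis .
    qed
  qed
  \<comment> \<open>This merges the two bounds \<open>b\<^sup>2\<close> near 0 and
    \<open>1 / t\<^sup>2\<close> near infinity into one integrable majorant.\<close>
  have bound: "(norm (g (of_real t)))\<^sup>2 \<le> (1 + b\<^sup>2) * inverse (1 + t\<^sup>2)" for t :: real
  proof (cases "t = 0")
    case False
    have "g (of_real t) = of_real (sin (b * t) / t)"
      using False by (simp add: g_def sin_of_real[symmetric])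
    then have n: "(norm (g (of_real t)))\<^sup>2 = (sin (b * t))\<^sup>2 / t\<^sup>2"
      by (simp add: norm_of_real power_divide del: of_real_divide)
    have "(sin (b * t))\<^sup>2 \<le> (b * t)\<^sup>2"
      using abs_sin_x_le_abs_x[of "b * t"] by (simp add: abs_le_square_iff)
    moreover have "(sin (b * t))\<^sup>2 * t\<^sup>2 \<le> 1 * t\<^sup>2"
      by (intro mult_right_mono) (simp_all add: abs_square_le_1)
    ultimately have "(sin (b * t))\<^sup>2 * (1 + t\<^sup>2) \<le> (1 + b\<^sup>2) * t\<^sup>2"
      by (simp add: algebra_simps power_mult_distrib)
    moreover have "0 < t\<^sup>2" "0 < 1 + t\<^sup>2" using False by (auto intro: add_pos_nonneg)
    ultimately show ?thesis unfolding n by (simp add: field_simps)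
  qed (simp add: g_def)
  have int: "integrable lborel (\<lambda>t::real. (norm (g (of_real t)))\<^sup>2)"
  proof (rule Bochner_Integration.integrable_bound)
    show "integrable lborel (\<lambda>t::real. (1 + b\<^sup>2) * inverse (1 + t\<^sup>2))"
      using integrable_inverse_1_plus_square by (simp add: set_integrable_def)
    show "(\<lambda>t::real. (norm (g (of_real t)))\<^sup>2) \<in> borel_measurable lborel"
      using borel_measurable_continuous_onI[OF cu] by simp
  qed (use bound in \<open>auto intro!: AE_I2 order_trans[OF _ abs_ge_self]\<close>)
  \<comment> \<open>A continuous nonnegative function with integral 0 vanishes on the interval, but
    \<open>g 0 = b\<close>.\<close>
  have "integral {-1..1} (\<lambda>t::real. (norm (g (of_real t)))\<^sup>2) \<noteq> 0"
    using b by (subst integral_eq_0_iff[OF cu]) (auto simp: g_def intro!: bexI[of _ 0])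
  moreover have "0 \<le> integral {-1..1} (\<lambda>t::real. (norm (g (of_real t)))\<^sup>2)"
    by (intro integral_nonneg integrable_continuous_real cu) auto
  ultimately have "0 < (LINT t|lborel. (norm (g (of_real t)))\<^sup>2)"
    using integral_interval_le_lborel[OF cu int, of "-1" 1] by simp
  then show ?thesis using that holg gtype int by (simp add: paley_wiener_def)
qed

lemma exp_type_modulate:
  assumes gtype: "exp_type_le b g"
  shows "exp_type_le (b + \<bar>s\<bar>) (\<lambda>z. exp (\<i> * of_real s * z) * g z)"
  unfolding exp_type_le_def
proof (intro allI impI)
  fix \<epsilon> :: real assume \<epsilon>: "0 < \<epsilon>"
  then obtain C where C: "\<And>z. norm (g z) \<le> C * exp ((b + \<epsilon>) * norm z)"
    using gtype unfolding exp_type_le_def by blast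
  have "norm (exp (\<i> * of_real s * z) * g z) \<le> C * exp ((b + \<bar>s\<bar> + \<epsilon>) * norm z)" for z
  proof -
    have "norm (exp (\<i> * of_real s * z)) \<le> exp (\<bar>s\<bar> * norm z)"
      using norm_exp[of "\<i> * of_real s * z"] by (simp add: norm_mult)
    then have "norm (exp (\<i> * of_real s * z) * g z) \<le> exp (\<bar>s\<bar> * norm z) * (C * exp ((b + \<epsilon>) * norm z))"
      unfolding norm_mult using C by (intro mult_mono) auto
    then show ?thesis by (simp add: exp_add[symmetric] algebra_simps)
  qed
  then show "\<exists>C. \<forall>z. norm (exp (\<i> * of_real s * z) * g z) \<le> C * exp ((b + \<bar>s\<bar> + \<epsilon>) * norm z)"
    by blast
qed

text \<open>Modulating a function of type \<open>a / 2\<close> by \<open>s\<close> moves its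
  spectrum from \<open>[-a/2, a/2]\<close> to one side of 0 and keeps the type at most
  \<open>a\<close>. Under translation by \<open>r * d\<close> the modulation contributes
  \<open>exp (- 2 * s * (r * Im d))\<close>, exactly the inverse of the Plancherel-Polya factor for
  type \<open>a / 2\<close>.\<close>

lemma paley_wiener_decreasing_translates:
  assumes a: "0 < a"
  obtains f where "f \<in> paley_wiener a" "0 < (LINT t|lborel. (norm (f (of_real t)))\<^sup>2)"
    "\<And>r::real. 0 \<le> r \<Longrightarrow> (LINT t|lborel. (norm (f (of_real t + of_real r * d)))\<^sup>2)
       \<le> (LINT t|lborel. (norm (f (of_real t)))\<^sup>2)"
proof -
  obtain g where g: "g \<in> paley_wiener (a / 2)" "0 < (LINT t|lborel. (norm (g (of_real t)))\<^sup>2)"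
    using paley_wiener_nontrivial[of "a / 2"] a by auto
  \<comment> \<open>The sign makes \<open>s * Im d\<close> equal to
    \<open>a / 2 * \<bar>Im d\<bar>\<close>.\<close>
  define s where "s = (if 0 \<le> Im d then a / 2 else - a / 2)"
  define f where "f = (\<lambda>z. exp (\<i> * of_real s * z) * g z)"
  have nrm: "(norm (f z))\<^sup>2 = exp (- 2 * s * Im z) * (norm (g z))\<^sup>2" for z
    by (simp add: f_def norm_mult power_mult_distrib power2_eq_square exp_add[symmetric])
  have "exp_type_le (a / 2 + \<bar>s\<bar>) f"
    unfolding f_def using g by (intro exp_type_modulate) (simp add: paley_wiener_def)
  then have "exp_type_le a f" using a by (simp add: s_def split: if_splits)
  moreover have "f holomorphic_on UNIV"
    unfolding f_def using g by (intro holomorphic_intros) (simp add: paley_wiener_def)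
  ultimately have "f \<in> paley_wiener a" using g by (simp add: paley_wiener_def nrm)
  moreover have "(LINT t|lborel. (norm (f (of_real t + of_real r * d)))\<^sup>2)
      \<le> (LINT t|lborel. (norm (f (of_real t)))\<^sup>2)" if r: "0 \<le> r" for r :: real
  proof -
    have "2 * (a / 2) * \<bar>Im (of_real r * d)\<bar> = 2 * s * (r * Im d)"
      using r a by (simp add: s_def abs_mult)
    then have "exp (- 2 * s * (r * Im d)) * (LINT t|lborel. (norm (g (of_real t + of_real r * d)))\<^sup>2)
        \<le> exp (- 2 * s * (r * Im d)) * (exp (2 * s * (r * Im d)) * (LINT t|lborel. (norm (g (of_real t)))\<^sup>2))"
      using plancherel_polya(2)[OF g(1), of "of_real r * d"] a by (intro mult_left_mono) simp_all
    then show ?thesis by (simp add: nrm mult.assoc[symmetric] exp_add[symmetric])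
  qed
  ultimately show ?thesis using that g by (simp add: nrm)
qed

section \<open>Geometric sums and the two cases of the equivalence\<close>

text \<open>For \<open>c = -1\<close> the orbit thus only meets translations by nonnegative
  multiples of \<open>d\<close>, the ones that \<open>paley_wiener_decreasing_translates\<close>
  controls.\<close>

lemma sum_power_neg_one_nonneg: "0 \<le> (\<Sum>k<n. (-1::real) ^ k)"
proof -
  have "(\<Sum>k<n. (-1::real) ^ k) = (if even n then 0 else 1)"
    by (induction n) auto
  then show ?thesis by simp
qed

lemma abs_sum_power_le:
  fixes c :: real
  assumes "\<bar>c\<bar> < 1"
  shows "\<bar>\<Sum>k<n. c ^ k\<bar> \<le> 1 / (1 - \<bar>c\<bar>)"
proof -
  have "\<bar>\<Sum>k<n. c ^ k\<bar> \<le> (\<Sum>k<n. \<bar>c\<bar> ^ k)"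
    using sum_abs[of "\<lambda>k. c ^ k" "{..<n}"] by (simp add: power_abs)
  also have "\<dots> \<le> (\<Sum>k. \<bar>c\<bar> ^ k)"
    using assms by (intro sum_le_suminf summable_geometric) auto
  also have "\<dots> = 1 / (1 - \<bar>c\<bar>)" using assms by (intro suminf_geometric) simp
  finally show ?thesis .
qed

lemma positively_expansive_if_contraction:
  assumes a: "0 \<le> a" and c: "c \<noteq> 0" "\<bar>c\<bar> < 1"
  shows "positively_expansive (paley_wiener a) pw_norm (comp_op (\<lambda>z. of_real c * z + d))"
  unfolding positively_expansive_def
proof (intro conjI ballI impI)
  have c1: "\<bar>c\<bar> \<le> 1" using c by simp
  show "bounded_linear_operator_on (paley_wiener a) pw_norm (comp_op (\<lambda>z. of_real c * z + d))"
    using comp_op_bounded[OF a c(1) c1] .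
  fix f assume f: "f \<in> paley_wiener a" and one: "pw_norm f = 1"
  \<comment> \<open>\<open>M\<close> bounds the Plancherel-Polya factors of all iterates at once,
    since the geometric sums are at most \<open>1 / (1 - \<bar>c\<bar>)\<close> in modulus.\<close>
  define M where "M = exp (2 * a * (1 / (1 - \<bar>c\<bar>) * \<bar>Im d\<bar>))"
  have M: "0 < M" by (simp add: M_def)
  \<comment> \<open>The 4 is the square of the target norm 2; the squared norm of the iterate is at
    least \<open>1 / (M * \<bar>c\<bar> ^ n)\<close>.\<close>
  then obtain m where m: "\<bar>c\<bar> ^ m < 1 / (4 * M)"
    using real_arch_pow_inv[of "1 / (4 * M)" "\<bar>c\<bar>"] c by auto
  \<comment> \<open>The successor guarantees a positive exponent, and
    \<open>\<bar>c\<bar> \<le> 1\<close> preserves the inequality.\<close>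
  define n where "n = Suc m"
  have "\<bar>c\<bar> ^ n \<le> \<bar>c\<bar> ^ m" using c1 unfolding n_def by (intro power_decreasing) auto
  then have "\<bar>c\<bar> ^ n < 1 / (4 * M)" using m by linarith
  then have cn: "0 < \<bar>c\<bar> ^ n" "4 * \<bar>c\<bar> ^ n \<le> 1 / M" using c by simp_all
  define I where "I = (LINT t|lborel. (norm (f (of_real t + of_real (\<Sum>k<n. c ^ k) * d)))\<^sup>2)"
  have I0: "0 \<le> I" by (simp add: I_def)
  have "\<bar>Im (of_real (\<Sum>k<n. c ^ k) * d)\<bar> \<le> 1 / (1 - \<bar>c\<bar>) * \<bar>Im d\<bar>"
    using mult_right_mono[OF abs_sum_power_le[OF c(2), of n], of "\<bar>Im d\<bar>"]
    by (simp add: abs_mult del: of_real_sum)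
  then have "exp (2 * a * \<bar>Im (of_real (\<Sum>k<n. c ^ k) * d)\<bar>) \<le> M"
    unfolding M_def exp_le_cancel_iff using a by (intro mult_left_mono) auto
  then have "exp (2 * a * \<bar>Im (of_real (\<Sum>k<n. c ^ k) * d)\<bar>) * I \<le> M * I"
    using I0 by (rule mult_right_mono)
  moreover have "(LINT t|lborel. (norm (f (of_real t)))\<^sup>2) = 1"
    using one by (simp add: pw_norm_eq)
  ultimately have "1 \<le> M * I"
    using plancherel_polya_lower[OF f a, of "of_real (\<Sum>k<n. c ^ k) * d"] unfolding I_def by linarith
  then have "1 / M \<le> I" using M by (simp add: field_simps)
  then have "4 * \<bar>c\<bar> ^ n \<le> I" using cn(2) by linarith
  then have "2\<^sup>2 \<le> (pw_norm ((comp_op (\<lambda>z. of_real c * z + d) ^^ n) f))\<^sup>2"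
    unfolding pw_norm_comp_op_funpow[OF f a c(1) c1] I_def[symmetric]
    using cn(1) by (simp add: pos_le_divide_eq)
  then have "2 \<le> pw_norm ((comp_op (\<lambda>z. of_real c * z + d) ^^ n) f)"
    by (rule power2_le_imp_le) (simp add: pw_norm_eq)
  then show "\<exists>n>0. 2 \<le> pw_norm ((comp_op (\<lambda>z. of_real c * z + d) ^^ n) f)"
    by (intro exI[of _ n]) (simp add: n_def)
qed

text \<open>The dilation by \<open>c\<close> is now isometric, so only the translations matter. The
  vector with nonincreasing translates, normalised to norm 1, has its whole orbit in the unit
  ball.\<close>

lemma not_positively_expansive_if_abs_eq_1:
  assumes a: "0 < a" and c: "\<bar>c\<bar> = 1"
  shows "\<not> positively_expansive (paley_wiener a) pw_norm (comp_op (\<lambda>z. of_real c * z + d))"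
proof -
  obtain f where f: "f \<in> paley_wiener a" and pos: "0 < (LINT t|lborel. (norm (f (of_real t)))\<^sup>2)"
    and decr: "\<And>r::real. 0 \<le> r \<Longrightarrow> (LINT t|lborel. (norm (f (of_real t + of_real r * d)))\<^sup>2)
       \<le> (LINT t|lborel. (norm (f (of_real t)))\<^sup>2)"
    using paley_wiener_decreasing_translates[OF a, of d] by blast
  define \<alpha> where "\<alpha> = complex_of_real (1 / pw_norm f)"
  define F where "F = (\<lambda>z. \<alpha> * f z)"
  have npos: "0 < pw_norm f" using pos by (simp add: pw_norm_eq)
  have F: "F \<in> paley_wiener a" unfolding F_def by (rule paley_wiener_scale[OF f])
  have one: "pw_norm F = 1"
    unfolding F_def pw_norm_scale using npos by (simp add: \<alpha>_def norm_divide)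
  have le: "pw_norm ((comp_op (\<lambda>z. of_real c * z + d) ^^ n) F) \<le> 1" for n
  proof (rule power2_le_imp_le)
    have "c = 1 \<or> c = -1" using c by linarith
    then have r: "0 \<le> (\<Sum>k<n. c ^ k)" using sum_power_neg_one_nonneg[of n] by auto
    have "(pw_norm ((comp_op (\<lambda>z. of_real c * z + d) ^^ n) F))\<^sup>2
        = (LINT t|lborel. (norm (F (of_real t + of_real (\<Sum>k<n. c ^ k) * d)))\<^sup>2)"
      using pw_norm_comp_op_funpow[OF F, of c n d] a c by auto
    also have "\<dots> = (norm \<alpha>)\<^sup>2 * (LINT t|lborel. (norm (f (of_real t + of_real (\<Sum>k<n. c ^ k) * d)))\<^sup>2)"
      by (simp add: F_def norm_mult power_mult_distrib del: of_real_sum)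
    also have "\<dots> \<le> (norm \<alpha>)\<^sup>2 * (LINT t|lborel. (norm (f (of_real t)))\<^sup>2)"
      by (intro mult_left_mono decr r) simp
    also have "\<dots> = (pw_norm F)\<^sup>2"
      by (simp add: pw_norm_eq F_def norm_mult power_mult_distrib)
    finally show "(pw_norm ((comp_op (\<lambda>z. of_real c * z + d) ^^ n) F))\<^sup>2 \<le> 1\<^sup>2" by (simp add: one)
  qed simp
  show ?thesis
  proof
    assume "positively_expansive (paley_wiener a) pw_norm (comp_op (\<lambda>z. of_real c * z + d))"
    then obtain n where "2 \<le> pw_norm ((comp_op (\<lambda>z. of_real c * z + d) ^^ n) F)"
      using F one unfolding positively_expansive_def by blast
    then show False using le[of n] by linarith
  qed
qed

theorem theorem4p4:
  fixes a c :: real and d :: complex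
  assumes "a > 0" and "0 < \<bar>c\<bar>" and "\<bar>c\<bar> \<le> 1"
  shows "positively_expansive (paley_wiener a) pw_norm
           (comp_op (\<lambda>z::complex. of_real c * z + d))
         \<longleftrightarrow> 0 < \<bar>c\<bar> \<and> \<bar>c\<bar> < 1"
proof (cases "\<bar>c\<bar> = 1")
  case True
  then show ?thesis using not_positively_expansive_if_abs_eq_1[OF assms(1) True] by simp
next
  case False
  then have "c \<noteq> 0" "\<bar>c\<bar> < 1" using assms by auto
  then show ?thesis using positively_expansive_if_contraction[of a c d] assms(1) by simp
qed

end
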